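(* Let $d\ge 2$, $\mu\in\mathbb{R}^d$, let $\Sigma\in\mathbb{R}^{d\times d}$ be symmetric and positive definite, let $h:\mathbb{R}_+\to\mathbb{R}_+$ satisfy $0<c_d(h)<\infty$, and let $P=\mathrm{Ell}_d(\mu,\Sigma;h)$. Then the quarter median of $P$ is unique and given by $\mu$. Moreover, if $P$ is strictly elliptical, then the solution of the quarter median problem for $P$ is unique and given by $(\mu,[U])$, where $U\in\mathbb{O}(d)$ is such that $\Sigma=U^{t}\operatorname{diag}(\lambda_1,\ldots,\lambda_d)\,U$ with $\lambda_1\ge\lambda_2\ge\cdots\ge\lambda_d>0$ the eigenvalues of $\Sigma$.
   Context: For $h:\mathbb{R}_+\to\mathbb{R}_+$ (measurable, $\mathbb{R}_+=[0,\infty)$) let $c_d(h)=\int_{\mathbb{R}^d}h(\|x\|^2)\,dx$. If $0<c_d(h)<\infty$, the elliptical distribution $\mathrm{Ell}_d(\mu,\Sigma;h)$ with location vector $\mu$ and dispersion matrix $\Sigma$ is the probability measure on $\mathbb{R}^d$ with density $$f(x)=\frac{1}{c_d(h)(\det\Sigma)^{1/2}}\,h\bigl((x-\mu)^{t}\Sigma^{-1}(x-\mu)\bigr),\quad x\in\mathbb{R}^d.$$ It is called strictly elliptical if no two of the eigenvalues $\lambda_1,\dots,\lambda_d$ of $\Sigma$ (listed with multiplicity) coincide. Vectors are columns, $x^{t}$ denotes the transpose, $\langle x,y\rangle=x^{t}y$, $\|\cdot\|$ is the Euclidean norm, $\mathbb{S}_{d-1}$ is the unit sphere in $\mathbb{R}^d$,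 $\mathbb{O}(d)$ is the group of orthogonal $d\times d$ matrices. For $a\in\mathbb{R}^d$ and $b\in\mathbb{S}_{d-1}$ let $H_-(a;b)=\{x:\langle b,x-a\rangle\le 0\}$ and $H_+(a;b)=\{x:\langle b,x-a\rangle\ge 0\}$. For orthogonal $b,b'\in\mathbb{S}_{d-1}$ and signs $\sigma,\sigma'\in\{+,-\}$ let $V_{\sigma\sigma'}(a;b,b')=H_\sigma(a;b)\cap H_{\sigma'}(a;b')$. A pair $(\theta,U)\in\mathbb{R}^d\times\mathbb{O}(d)$, where $U$ has rows $b_1^{t},\ldots,b_d^{t}$, solves the quarter median problem for $P$ if $P(H_\pm(\theta;b_i))\ge 1/2$ for $1\le i\le d$ and both signs, and $P(V_{\sigma\sigma'}(\theta;b_i,b_j))\ge 1/4$ for $1\le i<j\le d$ and all four sign combinations. Then $\theta$ is called a quarter median of $P$. For $U,V\in\mathbb{O}(d)$ write $U\sim V$ if the rows of $U$ and of $V$ determine the same set of linear hyperplanes $\{x:b_i^{t}x=0\}$; equivalently $V=AU$ for some $A\in G$, the finite group of signed permutation matrices. $[U]$ is the equivalence class of $U$. The quarter median of $P$ is unique and given by $\mu$ if $\mu$ is a quarter median and every solution $(\theta_1,U_1)$ of the quarter median problem has $\theta_1=\mu$. The solution of the quarter median problem is unique and given by $(\mu,[U])$ if $(\mu,U)$ is a solution and every solution $(\theta_1,U_1)$ satisfies $\theta_1=\mu$ and $U_1\sim U$. *)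

theory Defs
  imports "HOL-Analysis.Analysis" "HOL-Computational_Algebra.Polynomial"
begin

text \<open>
  The coordinates of R^d are indexed by a finite linearly ordered type with d elements; the order
  is what gives meaning to pairs of indices with \<open>i < j\<close> and to eigenvalues listed in
  decreasing order.
\<close>

definition diag_matrix :: "('d \<Rightarrow> real) \<Rightarrow> real^'d^'d" where
  "diag_matrix lam = (\<chi> i j. if i = j then lam i else 0)"

definition sym_pos_def :: "real^'d^'d \<Rightarrow> bool" where
  "sym_pos_def S \<longleftrightarrow> transpose S = S \<and> (\<forall>x. x \<noteq> 0 \<longrightarrow> x \<bullet> (S *v x) > 0)"

text \<open>The characteristic polynomial det(tI - S), as a determinant over the polynomial ring.\<close>

definition char_polynomial :: "real^'d^'d \<Rightarrow> real poly" where
  "char_polynomial S = det (\<chi> i j. [:- (S $ i $ j), if i = j then 1 else 0:])"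

text \<open>\<open>lam\<close> lists all eigenvalues of \<open>S\<close>, repeated according to their multiplicity.\<close>

definition lists_eigenvalues :: "('d \<Rightarrow> real) \<Rightarrow> real^'d^'d \<Rightarrow> bool" where
  "lists_eigenvalues lam S \<longleftrightarrow> char_polynomial S = (\<Prod>i\<in>UNIV. [:- lam i, 1:])"

text \<open>The constant \<open>c_d(h)\<close>; it takes values in \<open>[0, \<infinity>]\<close>, and the type argument supplies the dimension.\<close>

definition ell_const :: "'d::finite itself \<Rightarrow> (real \<Rightarrow> real) \<Rightarrow> ennreal" where
  "ell_const _ h = (\<integral>\<^sup>+ x. ennreal (h ((norm (x :: real^'d))\<^sup>2)) \<partial>lborel)"

definition elliptical :: "real^'d \<Rightarrow> real^'d^'d \<Rightarrow> (real \<Rightarrow> real) \<Rightarrow> (real^'d) measure" where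
  "elliptical \<mu> S h = density lborel (\<lambda>x. ennreal
     (1 / (enn2real (ell_const TYPE('d) h) * sqrt (det S))
        * h ((x - \<mu>) \<bullet> (matrix_inv S *v (x - \<mu>)))))"

definition strictly_elliptical :: "real^'d^'d \<Rightarrow> bool" where
  "strictly_elliptical S \<longleftrightarrow> (\<exists>lam. lists_eigenvalues lam S \<and> inj lam)"

datatype sign = Minus | Plus

fun halfspace :: "sign \<Rightarrow> real^'d \<Rightarrow> real^'d \<Rightarrow> (real^'d) set" where
  "halfspace Minus a b = {x. b \<bullet> (x - a) \<le> 0}"
| "halfspace Plus a b = {x. b \<bullet> (x - a) \<ge> 0}"

definition quarter_space ::
  "sign \<Rightarrow> sign \<Rightarrow> real^'d \<Rightarrow> real^'d \<Rightarrow> real^'d \<Rightarrow> (real^'d) set" where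
  "quarter_space s s' a b b' = halfspace s a b \<inter> halfspace s' a b'"

definition solves_qm ::
  "(real^'d::{finite,linorder}) measure \<Rightarrow>
    real^'d::{finite,linorder} \<Rightarrow>
    real^'d::{finite,linorder}^'d::{finite,linorder} \<Rightarrow>
    bool" where
  "solves_qm P \<theta> U \<longleftrightarrow>
     orthogonal_matrix U \<and>
     (\<forall>i s. measure P (halfspace s \<theta> (row i U)) \<ge> 1/2) \<and>
     (\<forall>i j s s'. i < j \<longrightarrow> measure P (quarter_space s s' \<theta> (row i U) (row j U)) \<ge> 1/4)"

definition quarter_median ::
  "(real^'d::{finite,linorder}) measure \<Rightarrow>
    real^'d::{finite,linorder} \<Rightarrow>
    bool" where
  "quarter_median P \<theta> \<longleftrightarrow> (\<exists>U. solves_qm P \<theta> U)"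

definition row_hyperplanes :: "real^'d^'d \<Rightarrow> (real^'d) set set" where
  "row_hyperplanes U = range (\<lambda>i. {x. row i U \<bullet> x = 0})"

definition hyperplane_equiv :: "real^'d^'d \<Rightarrow> real^'d^'d \<Rightarrow> bool" where
  "hyperplane_equiv U V \<longleftrightarrow> row_hyperplanes U = row_hyperplanes V"

definition unique_quarter_median ::
  "(real^'d::{finite,linorder}) measure \<Rightarrow>
    real^'d::{finite,linorder} \<Rightarrow>
    bool" where
  "unique_quarter_median P \<mu> \<longleftrightarrow>
     quarter_median P \<mu> \<and> (\<forall>\<theta> V. solves_qm P \<theta> V \<longrightarrow> \<theta> = \<mu>)"

text \<open>The solution is unique and given by \<open>\<mu>\<close> and the equivalence class of \<open>U\<close>.\<close>

definition unique_qm_solution ::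
  "(real^'d::{finite,linorder}) measure \<Rightarrow>
    real^'d::{finite,linorder} \<Rightarrow>
    real^'d::{finite,linorder}^'d::{finite,linorder} \<Rightarrow>
    bool" where
  "unique_qm_solution P \<mu> U \<longleftrightarrow>
     solves_qm P \<mu> U \<and> (\<forall>\<theta> V. solves_qm P \<theta> V \<longrightarrow> \<theta> = \<mu> \<and> hyperplane_equiv V U)"

definition ordered_diagonalization ::
  "real^'d::{finite,linorder}^'d::{finite,linorder} \<Rightarrow>
    ('d::{finite,linorder} \<Rightarrow>
    real) \<Rightarrow>
    real^'d::{finite,linorder}^'d::{finite,linorder} \<Rightarrow>
    bool" where
  "ordered_diagonalization U lam S \<longleftrightarrow>
     orthogonal_matrix U \<and>
     lists_eigenvalues lam S \<and> antimono lam \<and> (\<forall>i. lam i > 0) \<and>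
     S = transpose U ** diag_matrix lam ** U"

end

theory Submission
  imports Defs "HOL-Probability.Probability_Measure"
begin

text \<open>
  Write \<open>\<Sigma> = A A\<^sup>T\<close> with \<open>A\<close> invertible. Then the elliptical law is the image, under \<open>y \<mapsto> \<mu> + A y\<close>, of a
  law \<open>Q\<close> that is invariant under all orthogonal maps and gives no mass to hyperplanes
  (\<open>elliptical_eq_distr_spherical\<close>), and the quarter median problem becomes a question about the
  \<open>Q\<close>-mass of half-spaces and of wedges bounded by two hyperplanes through the origin.

  Three facts about \<open>Q\<close> decide it. A half-space that misses the origin by a positive distance has
  mass below one half (\<open>prob_halfspace_tail\<close>), which forces the centre of every solution to be
  \<open>\<mu>\<close>. A wedge with orthogonal normals has mass exactly one quarter (\<open>prob_wedge_orthogonal\<close>). A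
  wedge that opens by less than a right angle has mass below one quarter
  (\<open>prob_narrow_wedge\<close>). The strict inequalities rest on one observation,
  \<open>prob_open_meeting_spheres_pos\<close>: an open set that meets every sphere around the origin has
  positive \<open>Q\<close>-mass, since countably many rotated copies of it cover the space minus the origin.

  Consequently \<open>(\<theta>, V)\<close> solves the problem exactly if \<open>\<theta> = \<mu>\<close> and the rows of \<open>V\<close> are pairwise
  conjugate, that is \<open>\<langle>v\<^sub>i, \<Sigma> v\<^sub>j\<rangle> = 0\<close> for \<open>i \<noteq> j\<close> (\<open>solves_qm_affine_spherical_iff\<close>). The spectral
  theorem provides such a \<open>V\<close>. Conjugacy of an orthonormal system means that it consists of
  eigenvectors of \<open>\<Sigma>\<close>; if the eigenvalues are distinct, these are determined up to order and sign,
  so the hyperplanes of the rows are unique (\<open>row_hyperplanes_eq_if_diagonalizing\<close>).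
\<close>

section \<open>Orthogonal diagonalisation\<close>

lemma inner_matrix_vector_mult: "x \<bullet> (A *v y) = (transpose A *v x) \<bullet> y" for A :: "real^'n^'m"
  by (metis dot_lmul_matrix transpose_matrix_vector)

lemma matrix_congruence_nth:
  "(A ** S ** transpose A) $ i $ j = row i A \<bullet> (S *v row j A)" for A S :: "real^'d^'d"
proof -
  have "(A ** S ** transpose A) $ i $ j = (A *v (S *v row j A)) $ i"
    by (simp add: matrix_matrix_mult_def matrix_vector_mult_def transpose_def row_def sum_distrib_left
        sum_distrib_right) (subst sum.swap, simp add: ac_simps)
  then show ?thesis by (simp add: matrix_vector_mul_component row_def vec_lambda_eta)
qed

lemma diag_matrix_mult_vec: "diag_matrix d *v x = (\<chi> i. d i * x $ i)"
  by (simp add: vec_eq_iff diag_matrix_def matrix_vector_mult_def if_distrib[of "\<lambda>z. z * _"] cong: if_cong)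

lemma diag_matrix_mult: "diag_matrix c ** diag_matrix d = diag_matrix (\<lambda>i. c i * d i)"
  by (simp add: vec_eq_iff diag_matrix_def matrix_matrix_mult_def if_distrib[of "\<lambda>z. z * _"] cong: if_cong)

lemma diag_matrix_one: "diag_matrix (\<lambda>i. 1) = mat 1"
  by (simp add: diag_matrix_def mat_def)

lemma transpose_diag_matrix: "transpose (diag_matrix d) = diag_matrix d"
  by (auto simp: vec_eq_iff diag_matrix_def transpose_def)

lemma det_diag_matrix: "det (diag_matrix d) = (\<Prod>i\<in>UNIV. d i)"
  by (subst det_diagonal) (auto simp: diag_matrix_def)

text \<open>
  First-order condition at a maximum of the Rayleigh quotient: the quadratic form
  \<open>q x = \<langle>x, S x\<rangle> - m \<langle>x, x\<rangle>\<close>, with \<open>m\<close> the maximal value, is nonpositive on \<open>V\<close> and vanishes at \<open>u\<close>.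
  Along the line \<open>u + t w\<close> it equals \<open>2 t b + t\<^sup>2 c\<close>, and such a parabola stays nonpositive
  only if its linear coefficient \<open>b = \<langle>u, S w\<rangle>\<close> is zero.
\<close>

lemma rayleigh_maximum_stationary:
  fixes S :: "real^'d^'d"
  assumes sym: "transpose S = S" and V: "subspace V" and u: "u \<in> V" "norm u = 1"
    and max: "\<And>w. w \<in> V \<Longrightarrow> norm w = 1 \<Longrightarrow> w \<bullet> (S *v w) \<le> u \<bullet> (S *v u)"
    and w: "w \<in> V" "u \<bullet> w = 0"
  shows "u \<bullet> (S *v w) = 0"
proof -
  define m where "m = u \<bullet> (S *v u)"
  define q where "q x = x \<bullet> (S *v x) - m * (x \<bullet> x)" for x
  have q_le: "q x \<le> 0" if "x \<in> V" for x
  proof (cases "x = 0")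
    case False
    have "(x /\<^sub>R norm x) \<bullet> (S *v (x /\<^sub>R norm x)) \<le> m"
      unfolding m_def using that V False by (intro max) (auto simp: subspace_scale)
    then have "x \<bullet> (S *v x) / (norm x)\<^sup>2 \<le> m"
      by (simp add: matrix_vector_mult_scaleR power2_eq_square divide_inverse ac_simps)
    then show ?thesis using False by (simp add: q_def pos_divide_le_eq power2_norm_eq_inner)
  qed (simp add: q_def)
  have wu: "w \<bullet> (S *v u) = u \<bullet> (S *v w)"
    using sym by (metis inner_matrix_vector_mult inner_commute)
  have uu: "u \<bullet> u = 1" using u by (simp add: norm_eq_1)
  define b where "b = u \<bullet> (S *v w)"
  define c where "c = q w"
  have expand: "q (u + t *\<^sub>R w) = 2 * t * b + t\<^sup>2 * c" for t
    using w(2) wu uu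
    by (simp add: q_def c_def b_def m_def matrix_vector_right_distrib matrix_vector_mult_scaleR inner_simps
        inner_commute[of w u] power2_eq_square algebra_simps)
  have le: "2 * t * b + t\<^sup>2 * c \<le> 0" for t
    using q_le[of "u + t *\<^sub>R w"] u w V by (simp add: expand subspace_add subspace_scale)
  have "c \<le> 0" using q_le w by (simp add: c_def)
  have "b = 0"
  proof (rule ccontr)
    assume b: "b \<noteq> 0"
    \<comment> \<open>Any \<open>t = b / e\<close> with \<open>2 * e + c > 0\<close> makes the parabola positive; since \<open>c \<le> 0\<close>, \<open>e = 1 - c\<close> will do.\<close>
    define e where "e = 1 - c"
    define t where "t = b / e"
    have "e \<noteq> 0" using \<open>c \<le> 0\<close> by (simp add: e_def)
    then have "2 * t * b + t\<^sup>2 * c = b\<^sup>2 * (2 * e + c) / e\<^sup>2"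
      by (simp add: t_def field_simps power2_eq_square)
    also have "\<dots> > 0" using b \<open>c \<le> 0\<close> \<open>e \<noteq> 0\<close> unfolding e_def by (intro divide_pos_pos mult_pos_pos) auto
    finally show False using le[of t] by simp
  qed
  then show ?thesis by (simp add: b_def)
qed

text \<open>
  Choose the rows greedily along the order of the index type: \<open>u i\<close> maximises the Rayleigh quotient
  among the unit vectors orthogonal to all \<open>u j\<close> with \<open>j < i\<close>. The first-order condition makes
  distinct rows orthogonal with respect to \<open>S\<close>, and since the sets over which one maximises shrink,
  the maximal values come out in decreasing order without any sorting.
\<close>

theorem spectral_theorem_antimono:
  fixes S :: "real^'d::{finite,linorder}^'d::{finite,linorder}"
  assumes sym: "transpose S = S"
  obtains U lam where "orthogonal_matrix U" "antimono lam" "S = transpose U ** diag_matrix lam ** U"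
proof -
  define V where "V f i = {w. \<forall>j<i. w \<bullet> f j = 0}" 
    for f :: "'d::{finite,linorder} \<Rightarrow> real^'d::{finite,linorder}" and i
  define best where "best f i r \<longleftrightarrow> r \<in> V f i \<and> norm r = 1 \<and>
      (\<forall>w\<in>V f i. norm w = 1 \<longrightarrow> w \<bullet> (S *v w) \<le> r \<bullet> (S *v r))" 
    for f :: "'d::{finite,linorder} \<Rightarrow> real^'d::{finite,linorder}" and i r
  have subsp: "subspace (V f i)" for f i
    by (auto simp: V_def subspace_def inner_simps)
  have "\<exists>u. \<forall>i. best u i (u i)"
  proof (rule dependent_wf_choice)
    show "wf {(j :: 'd::{finite,linorder}, i). j < i}"
      using wf_finite_segments[of "{(j :: 'd::{finite,linorder}, i). j < i}"]
      by (simp add: irrefl_def trans_def) (meson less_trans)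
    show "best f i r = best g i r" if "\<And>z. (z, i) \<in> {(j, i). j < i} \<Longrightarrow> f z = g z" for f g i r
    proof -
      have "V f i = V g i" using that by (auto simp: V_def)
      then show ?thesis by (simp add: best_def)
    qed
    fix i :: "'d::{finite,linorder}" and f :: "'d::{finite,linorder} \<Rightarrow> real^'d::{finite,linorder}"
    have "dim (f ` {..<i}) \<le> card (f ` {..<i})" by (intro dim_le_card') simp
    also have "\<dots> \<le> card {..<i}" by (rule card_image_le) simp
    also have "\<dots> < CARD('d::{finite,linorder})" by (rule psubset_card_mono) auto
    finally obtain x where x: "x \<noteq> 0" "\<And>y. y \<in> span (f ` {..<i}) \<Longrightarrow> orthogonal x y"
      using orthogonal_to_subspace_exists[of "f ` {..<i}"] by auto
    have "x /\<^sub>R norm x \<in> V f i \<inter> sphere 0 1"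
      using x by (auto simp: V_def orthogonal_def span_base)
    moreover have "compact (V f i \<inter> sphere 0 1)"
      by (intro closed_Int_compact closed_subspace subsp) auto
    moreover have "continuous_on (V f i \<inter> sphere 0 1) (\<lambda>w. w \<bullet> (S *v w))"
      by (intro continuous_intros)
    ultimately obtain r where "r \<in> V f i \<inter> sphere 0 1"
        "\<forall>w\<in>V f i \<inter> sphere 0 1. w \<bullet> (S *v w) \<le> r \<bullet> (S *v r)"
      using continuous_attains_sup[of "V f i \<inter> sphere 0 1" "\<lambda>w. w \<bullet> (S *v w)"] by blast
    then show "\<exists>r. best f i r" by (auto simp: best_def)
  qed
  then obtain u where "\<And>i. best u i (u i)" by blast
  then have u: "u i \<in> V u i" "norm (u i) = 1"
    and u_max: "\<And>w. w \<in> V u i \<Longrightarrow> norm w = 1 \<Longrightarrow> w \<bullet> (S *v w) \<le> u i \<bullet> (S *v u i)" for i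
    by (auto simp: best_def)
  have V_mono: "V u j \<subseteq> V u i" if "i \<le> j" for i j
    using that by (auto simp: V_def)
  have ortho_less: "u i \<bullet> u j = 0 \<and> u i \<bullet> (S *v u j) = 0" if "i < j" for i j
  proof
    show ij: "u i \<bullet> u j = 0" using u(1)[of j] that by (auto simp: V_def inner_commute)
    have "u j \<in> V u i" using u(1)[of j] V_mono[OF less_imp_le[OF that]] by auto
    then show "u i \<bullet> (S *v u j) = 0"
      using rayleigh_maximum_stationary[OF sym subsp u u_max _ ij] by blast
  qed
  have S_comm: "u i \<bullet> (S *v u j) = u j \<bullet> (S *v u i)" for i j
    using sym by (metis inner_matrix_vector_mult inner_commute)
  have ortho: "u i \<bullet> u j = 0 \<and> u i \<bullet> (S *v u j) = 0" if "i \<noteq> j" for i j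
    using that ortho_less[of i j] ortho_less[of j i] S_comm[of i j] inner_commute[of "u i" "u j"]
    by (cases i j rule: linorder_cases) auto
  define U where "U = (\<chi> i. u i)"
  define lam where "lam i = u i \<bullet> (S *v u i)" for i
  have row: "row i U = u i" for i by (simp add: U_def row_def vec_lambda_eta)
  have U: "orthogonal_matrix U"
    using u(2) ortho by (simp add: orthogonal_matrix_orthonormal_rows row orthogonal_def)
  show thesis
  proof
    show "antimono lam"
    proof (rule antimonoI)
      fix i j :: "'d::{finite,linorder}" assume "i \<le> j"
      then show "lam j \<le> lam i" unfolding lam_def using u(1)[of j] u(2) V_mono by (intro u_max) auto
    qed
    have "U ** S ** transpose U = diag_matrix lam"
      using ortho by (auto simp: vec_eq_iff matrix_congruence_nth row diag_matrix_def lam_def)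
    then have "transpose U ** diag_matrix lam ** U = (transpose U ** U) ** S ** (transpose U ** U)"
      by (simp only: matrix_mul_assoc flip: \<open>U ** S ** transpose U = diag_matrix lam\<close>)
    also have "\<dots> = S" using U by (simp add: orthogonal_matrix_def)
    finally show "S = transpose U ** diag_matrix lam ** U" by simp
  qed (rule U)
qed

text \<open>
  The conjugation can be carried out over the polynomial ring: with \<open>U\<close> read as a matrix \<open>C\<close> of
  constant polynomials, \<open>t I - S\<close> is \<open>C\<^sup>T D C\<close> for the diagonal matrix \<open>D\<close> of the linear
  factors, and \<open>det (C\<^sup>T C) = 1\<close>.
\<close>

lemma lists_eigenvalues_orthogonal_diagonalization:
  fixes U :: "real^'d^'d"
  assumes U: "orthogonal_matrix U" and S: "S = transpose U ** diag_matrix lam ** U"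
  shows "lists_eigenvalues lam S"
proof -
  define C where "C = (\<chi> i j. [:U $ i $ j:])"
  define D :: "real poly^'d^'d" where "D = (\<chi> i j. if i = j then [:- lam i, 1:] else 0)"
  have poly_sum: "(\<Sum>k\<in>A. [:f k, g k:]) = [:sum f A, sum g A:]" for f g :: "'d \<Rightarrow> real" and A
    by (induction A rule: infinite_finite_induct) auto
  have "transpose U ** U = mat 1" using U by (simp add: orthogonal_matrix_def)
  then have UU: "(\<Sum>k\<in>UNIV. U $ k $ i * U $ k $ j) = (if i = j then 1 else 0)" for i j
    by (simp add: vec_eq_iff matrix_matrix_mult_def transpose_def mat_def)
  have CC: "transpose C ** C = mat 1"
  proof -
    have "(\<Sum>k\<in>UNIV. [:U $ k $ i * U $ k $ j, 0:]) = [:if i = j then 1 else 0, 0:]" for i j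
      unfolding poly_sum UU by simp
    then show ?thesis
      by (simp add: vec_eq_iff matrix_matrix_mult_def transpose_def mat_def C_def one_pCons)
  qed
  have "(transpose C ** D ** C) $ i $ j = [:- (S $ i $ j), if i = j then 1 else 0:]" for i j
  proof -
    have "(transpose C ** D ** C) $ i $ j = (\<Sum>k\<in>UNIV. [:- (U $ k $ i * lam k * U $ k $ j), U $ k $ i * U $ k $ j:])"
      by (simp add: matrix_matrix_mult_def transpose_def C_def D_def if_distrib[of "\<lambda>z. _ * z"] ac_simps cong: if_cong)
    also have "\<dots> = [:- (S $ i $ j), if i = j then 1 else 0:]"
      unfolding poly_sum UU S
      by (simp add: matrix_matrix_mult_def transpose_def diag_matrix_def sum_negf if_distrib[of "\<lambda>z. _ * z"] ac_simps cong: if_cong)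
    finally show ?thesis .
  qed
  then have "char_polynomial S = det (transpose C ** D ** C)"
    unfolding char_polynomial_def by (metis (no_types, lifting) vec_lambda_unique)
  also have "\<dots> = det (transpose C ** C) * det D"
    by (simp only: det_mul ac_simps)
  also have "\<dots> = (\<Prod>i\<in>UNIV. [:- lam i, 1:])"
    by (simp add: CC det_diagonal D_def)
  finally show ?thesis by (simp add: lists_eigenvalues_def)
qed

text \<open>
  Both lists have the zeros of the characteristic polynomial as their range, so they have
  equally many distinct entries.
\<close>

lemma inj_lists_eigenvalues:
  fixes S :: "real^'d^'d"
  assumes "lists_eigenvalues lam S" "lists_eigenvalues lam' S" "inj lam'"
  shows "inj lam"
proof -
  have roots: "{x. poly (char_polynomial S) x = 0} = range c" if "lists_eigenvalues c S" for c
    using that by (auto simp: lists_eigenvalues_def poly_prod)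
  have "range lam = range lam'" using roots assms(1,2) by metis
  then have "card (range lam) = CARD('d)" using assms(3) by (simp add: card_image)
  then show ?thesis by (simp add: eq_card_imp_inj_on)
qed

text \<open>
  If the rows of \<open>V\<close> are conjugate with respect to \<open>S\<close>, then \<open>V\<close> diagonalises \<open>S\<close> as well, so its
  rows are eigenvectors. The eigenvalues being distinct, the eigenspaces are the lines spanned by
  the rows of \<open>U\<close>, and each row of \<open>V\<close> is a multiple of a row of \<open>U\<close>. The matrix
  \<open>W = U V\<^sup>T\<close> records which one: it has exactly one nonzero entry in each row and column.
\<close>

lemma row_hyperplanes_eq_if_diagonalizing:
  fixes U V S :: "real^'d^'d"
  assumes U: "orthogonal_matrix U" and S: "S = transpose U ** diag_matrix lam ** U" and inj: "inj lam"
    and V: "orthogonal_matrix V" and conj: "\<And>i j. i \<noteq> j \<Longrightarrow> row i V \<bullet> (S *v row j V) = 0"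
  shows "row_hyperplanes V = row_hyperplanes U"
proof -
  define m where "m i = row i V \<bullet> (S *v row i V)" for i
  define W where "W = U ** transpose V"
  have UU: "U ** transpose U = mat 1" "transpose U ** U = mat 1"
    and VV: "transpose V ** V = mat 1" "V ** transpose V = mat 1"
    using U V by (auto simp: orthogonal_matrix_def)
  have "V ** S ** transpose V = diag_matrix m"
    using conj by (auto simp: vec_eq_iff matrix_congruence_nth diag_matrix_def m_def)
  then have "W ** diag_matrix m = U ** (transpose V ** V) ** S ** transpose V"
    by (simp only: W_def flip: matrix_mul_assoc)
  also have "\<dots> = (U ** transpose U) ** diag_matrix lam ** W"
    by (simp only: S VV W_def matrix_mul_rid matrix_mul_assoc)
  finally have "W ** diag_matrix m = diag_matrix lam ** W"
    by (simp add: UU)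
  then have "(W ** diag_matrix m) $ k $ i = (diag_matrix lam ** W) $ k $ i" for k i by simp
  then have W_eigen: "W $ k $ i * m i = lam k * W $ k $ i" for k i
    by (simp add: matrix_matrix_mult_def diag_matrix_def if_distrib[of "\<lambda>z. _ * z"] if_distrib[of "\<lambda>z. z * _"] cong: if_cong)
  have WW: "W ** transpose W = mat 1" "transpose W ** W = mat 1"
    by (simp_all add: W_def matrix_transpose_mul matrix_mul_assoc)
       (metis UU VV matrix_mul_assoc matrix_mul_rid)+
  have VU: "V = transpose W ** U"
    by (simp add: W_def matrix_transpose_mul matrix_mul_assoc[symmetric] UU)
  have parallel: "{x. row i V \<bullet> x = 0} = {x. row k U \<bullet> x = 0}" if nz: "W $ k $ i \<noteq> 0" for i k
  proof -
    have other: "W $ l $ i = 0" if "l \<noteq> k" for l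
      using W_eigen[of l i] W_eigen[of k i] nz that inj by (auto simp: inj_eq mult.commute[of _ "m i"])
    have "row i V = W $ k $ i *\<^sub>R row k U"
    proof -
      have "V $ i $ j = W $ k $ i * U $ k $ j" for j
      proof -
        have "V $ i $ j = (\<Sum>l\<in>UNIV. W $ l $ i * U $ l $ j)"
          unfolding VU by (simp add: matrix_matrix_mult_def transpose_def)
        also have "\<dots> = (\<Sum>l\<in>UNIV. if l = k then W $ k $ i * U $ k $ j else 0)"
          using other by (intro sum.cong) auto
        finally show ?thesis by simp
      qed
      then show ?thesis by (simp add: vec_eq_iff row_def)
    qed
    then show ?thesis using nz by auto
  qed
  have col: "\<exists>k. W $ k $ i \<noteq> 0" for i
  proof (rule ccontr)
    assume "\<not> ?thesis"
    then have "(transpose W ** W) $ i $ i = 0" by (simp add: matrix_matrix_mult_def)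
    then show False by (simp add: WW mat_def)
  qed
  have row: "\<exists>i. W $ k $ i \<noteq> 0" for k
  proof (rule ccontr)
    assume "\<not> ?thesis"
    then have "(W ** transpose W) $ k $ k = 0" by (simp add: matrix_matrix_mult_def)
    then show False by (simp add: WW mat_def)
  qed
  show ?thesis
    unfolding row_hyperplanes_def using parallel col row by (auto simp: image_iff) metis+
qed

lemma orthogonal_conjugate_eq_diag:
  fixes U :: "real^'d^'d"
  assumes "orthogonal_matrix U" "S = transpose U ** diag_matrix lam ** U"
  shows "U ** S ** transpose U = diag_matrix lam"
proof -
  have UU: "U ** transpose U = mat 1" using assms by (simp add: orthogonal_matrix_def)
  have "U ** S ** transpose U = (U ** transpose U) ** diag_matrix lam ** (U ** transpose U)"
    by (simp only: assms(2) matrix_mul_assoc)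
  then show ?thesis by (simp add: UU)
qed

lemma diag_pos_if_sym_pos_def:
  fixes U :: "real^'d^'d"
  assumes "sym_pos_def S" "orthogonal_matrix U" "S = transpose U ** diag_matrix lam ** U"
  shows "0 < lam i"
proof -
  have USU: "U ** S ** transpose U = diag_matrix lam"
    by (rule orthogonal_conjugate_eq_diag) fact+
  have "row i U \<noteq> 0"
    using assms(2) by (metis norm_zero orthogonal_matrix_orthonormal_rows zero_neq_one)
  then have "0 < row i U \<bullet> (S *v row i U)" using assms(1) by (simp add: sym_pos_def_def)
  also have "\<dots> = lam i" by (simp add: USU diag_matrix_def flip: matrix_congruence_nth)
  finally show ?thesis .
qed

lemma matrix_inv_eqI:
  fixes A :: "real^'n^'n"
  assumes "A ** B = mat 1" "B ** A = mat 1"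
  shows "matrix_inv A = B"
proof -
  have "A ** matrix_inv A = mat 1 \<and> matrix_inv A ** A = mat 1"
    unfolding matrix_inv_def
    using someI[of "\<lambda>X. A ** X = mat 1 \<and> X ** A = mat 1" B] assms by simp
  then have "(matrix_inv A ** A) ** B = B" by simp
  then show ?thesis by (simp add: assms flip: matrix_mul_assoc)
qed

section \<open>Lebesgue measure under orthogonal and affine maps\<close>

lemma continuous_on_orthogonal_transformation:
  fixes f :: "'a::euclidean_space \<Rightarrow> 'a"
  shows "orthogonal_transformation f \<Longrightarrow> continuous_on S f"
  by (simp add: orthogonal_transformation_linear linear_continuous_on linear_linear)

text \<open>
  By Vitali's covering theorem an open set is, up to a null set, a countable disjoint union of balls,
  and the preimage of a ball under an isometry is a ball of the same radius.
\<close>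

lemma emeasure_lborel_vimage_orthogonal_ge:
  fixes f :: "'a::euclidean_space \<Rightarrow> 'a"
  assumes f: "orthogonal_transformation f" and S: "open S"
  shows "emeasure lborel S \<le> emeasure lborel (f -` S)"
proof -
  define K where "K = {(x, r). 0 < r \<and> ball x r \<subseteq> S}"
  obtain C where C: "countable C" "C \<subseteq> K"
      "pairwise (\<lambda>i j. disjnt (ball (fst i) (snd i)) (ball (fst j) (snd j))) C"
      "negligible (S - (\<Union>i\<in>C. ball (fst i) (snd i)))"
  proof (rule Vitali_covering_theorem_balls[of S K fst snd])
    fix x and d :: real assume "x \<in> S" "0 < d"
    then obtain e where "0 < e" "ball x e \<subseteq> S" using S by (meson openE)
    then have "(x, min e (d/2)) \<in> K" using \<open>0 < d\<close> by (auto simp: K_def)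
    then show "\<exists>i. i \<in> K \<and> x \<in> ball (fst i) (snd i) \<and> snd i < d"
      using \<open>0 < d\<close> \<open>0 < e\<close> by (intro exI[of _ "(x, min e (d/2))"]) auto
  qed
  let ?B = "\<lambda>i. ball (fst i) (snd i) :: 'a set"
  have f_cont: "continuous_on UNIV f"
    using f by (rule continuous_on_orthogonal_transformation)
  have disj: "disjoint_family_on ?B C"
    using C(3) by (auto simp: disjoint_family_on_def pairwise_def disjnt_def)
  have ball: "f -` ball x r = ball (inv f x) r" for x r
  proof -
    have "dist x (f y) = dist (inv f x) y" for y
      using f by (metis orthogonal_transformation_isometry orthogonal_transformation_surj surj_f_inv_f)
    then show ?thesis by auto
  qed
  have "emeasure lborel S \<le> emeasure lborel (\<Union>i\<in>C. ?B i)"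
  proof -
    have balls: "(\<Union>i\<in>C. ?B i) \<in> sets borel" by (intro borel_open open_UN) auto
    have null: "S - (\<Union>i\<in>C. ?B i) \<in> null_sets lborel"
    proof -
      have "S - (\<Union>i\<in>C. ?B i) \<in> sets borel"
        using S balls by (intro sets.Diff) auto
      then show ?thesis using C(4) by (simp add: negligible_iff_null_sets null_sets_completion_iff)
    qed
    have "emeasure lborel S \<le> emeasure lborel ((\<Union>i\<in>C. ?B i) \<union> (S - (\<Union>i\<in>C. ?B i)))"
      using balls S by (intro emeasure_mono sets.Un) auto
    also have "\<dots> = emeasure lborel (\<Union>i\<in>C. ?B i)"
      using null balls by (intro emeasure_Un_null_set) auto
    finally show ?thesis .
  qed
  also have "\<dots> = (\<integral>\<^sup>+i. emeasure lborel (?B i) \<partial>count_space C)"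
    using C(1) disj by (intro emeasure_UN_countable) auto
  also have "\<dots> = (\<integral>\<^sup>+i. emeasure lborel (f -` ?B i) \<partial>count_space C)"
  proof (rule nn_integral_cong)
    fix i assume "i \<in> space (count_space C)"
    then have "0 < snd i" using C(2) by (auto simp: K_def)
    then show "emeasure lborel (?B i) = emeasure lborel (f -` ?B i)"
      by (simp add: ball emeasure_ball)
  qed
  also have "\<dots> = emeasure lborel (\<Union>i\<in>C. f -` ?B i)"
  proof (rule emeasure_UN_countable[symmetric])
    show "disjoint_family_on (\<lambda>i. f -` ?B i) C"
      using disj by (fastforce simp: disjoint_family_on_def)
  qed (auto simp: ball C(1))
  also have "\<dots> \<le> emeasure lborel (f -` S)"
  proof (rule emeasure_mono)
    show "(\<Union>i\<in>C. f -` ?B i) \<subseteq> f -` S" using C(2) by (fastforce simp: K_def)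
    show "f -` S \<in> sets lborel" using open_vimage[OF S f_cont] by simp
  qed
  finally show ?thesis .
qed

text \<open>
  The preceding inequality, applied to \<open>f\<close> and to its inverse, is an equality.
\<close>

lemma lborel_distr_orthogonal:
  fixes f :: "'a::euclidean_space \<Rightarrow> 'a"
  assumes f: "orthogonal_transformation f"
  shows "distr lborel borel f = lborel"
proof (rule lborel_eqI[symmetric])
  have f_cont: "continuous_on UNIV f"
    using f by (rule continuous_on_orthogonal_transformation)
  then have [measurable]: "f \<in> borel_measurable borel" by (rule borel_measurable_continuous_onI)
  have bij: "bij f" using f by (rule orthogonal_transformation_bij)
  fix l u :: 'a assume lu: "\<And>b. b \<in> Basis \<Longrightarrow> l \<bullet> b \<le> u \<bullet> b"
  have "emeasure lborel (f -` box l u) \<le> emeasure lborel (inv f -` (f -` box l u))"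
    using f f_cont by (intro emeasure_lborel_vimage_orthogonal_ge orthogonal_transformation_inv open_vimage) auto
  also have "inv f -` (f -` box l u) = box l u"
    using bij by (auto simp: bij_def surj_f_inv_f)
  finally have "emeasure lborel (f -` box l u) = emeasure lborel (box l u)"
    by (intro antisym emeasure_lborel_vimage_orthogonal_ge f) auto
  then show "emeasure (distr lborel borel f) (box l u) = (\<Prod>b\<in>Basis. (u - l) \<bullet> b)"
    using lu by (simp add: emeasure_distr emeasure_lborel_box_eq)
qed simp

lemma lborel_eq_density_distr_diag:
  fixes s :: "'d::finite \<Rightarrow> real"
  assumes s: "\<And>i. 0 < s i"
  shows "lborel = density (distr lborel borel (\<lambda>y. diag_matrix s *v y)) (\<lambda>_. ennreal (\<Prod>i\<in>UNIV. s i))"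
proof -
  define c where "c b = s (axis_index b)" for b :: "real^'d"
  have idx: "axis_index (axis i (1::real)) = i" for i :: 'd
    by (simp add: axis_index_def axis_eq_axis)
  have B: "Basis = range (\<lambda>i::'d. axis i (1::real))" by (auto simp: Basis_vec_def)
  have inj: "inj (\<lambda>i::'d. axis i (1::real))" by (auto simp: inj_def axis_eq_axis)
  have "(\<Prod>b\<in>Basis. ennreal \<bar>c b\<bar>) = ennreal (\<Prod>i\<in>UNIV. s i)"
    unfolding B using s by (subst prod.reindex[OF inj]) (simp add: c_def idx prod_ennreal less_imp_le abs_of_pos)
  moreover have "0 + (\<Sum>b\<in>Basis. (c b * (y \<bullet> b)) *\<^sub>R b) = diag_matrix s *v y" for y
    unfolding B by (subst sum.reindex[OF inj])
      (simp add: c_def idx diag_matrix_mult_vec vec_eq_iff inner_axis,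
       simp add: axis_def if_distrib[of "\<lambda>z. _ * z"] cong: if_cong)
  moreover have "c b \<noteq> 0" for b using s[of "axis_index b"] by (simp add: c_def)
  ultimately show ?thesis
    using lborel_affine_euclidean[of c 0] by (simp add: prod_ennreal)
qed

text \<open>
  Change of variables \<open>x = \<mu> + U D y\<close>: the orthogonal factor and the translation preserve Lebesgue
  measure, so only the diagonal factor contributes to the Jacobian.
\<close>

lemma lborel_eq_density_distr_affine:
  fixes U :: "real^'d^'d"
  assumes U: "orthogonal_matrix U" and s: "\<And>i. 0 < s i"
  shows "lborel = density (distr lborel borel (\<lambda>y. \<mu> + (U ** diag_matrix s) *v y)) (\<lambda>_. ennreal (\<Prod>i\<in>UNIV. s i))"
proof -
  let ?c = "ennreal (\<Prod>i\<in>UNIV. s i)"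
  have [measurable]: "(\<lambda>y. M *v y) \<in> borel_measurable borel" for M :: "real^'d^'d"
    by (intro borel_measurable_continuous_onI continuous_intros)
  have "lborel = distr lborel borel ((+) \<mu>)" by (simp add: lborel_distr_plus)
  also have "\<dots> = distr (distr lborel borel ((*v) U)) borel ((+) \<mu>)"
    using U by (simp add: lborel_distr_orthogonal orthogonal_transformation_matrix)
  also have "\<dots> = distr lborel borel (\<lambda>z. \<mu> + U *v z)"
    by (subst distr_distr) (auto simp: comp_def)
  also have "\<dots> = distr (density (distr lborel borel (\<lambda>y. diag_matrix s *v y)) (\<lambda>_. ?c)) borel (\<lambda>z. \<mu> + U *v z)"
    by (subst lborel_eq_density_distr_diag[OF s]) (rule refl)
  also have "\<dots> = density (distr (distr lborel borel (\<lambda>y. diag_matrix s *v y)) borel (\<lambda>z. \<mu> + U *v z)) (\<lambda>_. ?c)"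
    by (rule density_distr[symmetric]) measurable
  also have "distr (distr lborel borel (\<lambda>y. diag_matrix s *v y)) borel (\<lambda>z. \<mu> + U *v z) =
      distr lborel borel (\<lambda>y. \<mu> + (U ** diag_matrix s) *v y)"
    by (subst distr_distr) (auto simp: comp_def matrix_vector_mul_assoc)
  finally show ?thesis .
qed

section \<open>Spherical laws\<close>

definition wedge :: "real^'d \<Rightarrow> real^'d \<Rightarrow> (real^'d) set" where
  "wedge a b = {y. 0 \<le> a \<bullet> y \<and> 0 \<le> b \<bullet> y}"

lemma closed_wedge: "closed (wedge a b)"
  unfolding wedge_def by (intro closed_Collect_conj closed_Collect_le continuous_intros)

lemma orthogonal_transformation_reflection:
  fixes a :: "'a::euclidean_space"
  shows "orthogonal_transformation (\<lambda>y. y - (2 * (a \<bullet> y) / (a \<bullet> a)) *\<^sub>R a)"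
proof (cases "a = 0")
  case False
  have "linear (\<lambda>y. y - (2 * (a \<bullet> y) / (a \<bullet> a)) *\<^sub>R a)"
    by (rule linearI) (simp_all add: inner_simps algebra_simps add_divide_distrib)
  moreover have "(v - (2 * (a \<bullet> v) / (a \<bullet> a)) *\<^sub>R a) \<bullet> (w - (2 * (a \<bullet> w) / (a \<bullet> a)) *\<^sub>R a) = v \<bullet> w" for v w
    using False by (simp add: inner_simps field_simps inner_commute)
  ultimately show ?thesis unfolding orthogonal_transformation_def by blast
qed simp

locale spherical_law = prob_space Q for Q :: "(real^'d) measure" +
  assumes sets_Q [measurable_cong, simp]: "sets Q = sets borel"
    and distr_orthogonal: "orthogonal_transformation f \<Longrightarrow> distr Q borel f = Q"
    and prob_hyperplane: "a \<noteq> 0 \<Longrightarrow> prob {y. a \<bullet> y = 0} = 0"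
begin

lemma space_Q [simp]: "space Q = UNIV"
  using sets_eq_imp_space_eq[OF sets_Q] by simp

lemma prob_vimage_orthogonal:
  assumes "orthogonal_transformation f" and S: "S \<in> sets borel"
  shows "prob (f -` S) = prob S"
proof -
  have "continuous_on UNIV f"
    using assms(1) by (rule continuous_on_orthogonal_transformation)
  then have "f \<in> borel_measurable borel" by (rule borel_measurable_continuous_onI)
  then show ?thesis
    using measure_distr[of f Q borel S] assms distr_orthogonal by simp
qed

text \<open>
  The rotated copies of \<open>S\<close> cover everything except the origin, because rotations are transitive on
  spheres. By Lindelof countably many copies suffice; if \<open>S\<close> were null, so would be the whole
  space. It is applied to strips around a hyperplane and to open cones.
\<close>

lemma prob_open_meeting_spheres_pos:
  assumes S: "open S" and meets: "\<And>r. 0 < r \<Longrightarrow> \<exists>y\<in>S. norm y = r"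
  shows "0 < prob S"
proof (rule ccontr)
  assume "\<not> 0 < prob S"
  then have S0: "prob S = 0" using measure_nonneg[of Q S] by linarith
  define F where "F = {f -` S | f :: real^'d \<Rightarrow> real^'d. orthogonal_transformation f}"
  have F_open: "open T" if T: "T \<in> F" for T
  proof -
    obtain f where "orthogonal_transformation f" "T = f -` S" using T by (auto simp: F_def)
    then show ?thesis using S continuous_on_orthogonal_transformation[of f UNIV] by (simp add: open_vimage)
  qed
  then obtain F' where F': "F' \<subseteq> F" "countable F'" "\<Union>F' = \<Union>F"
    by (metis Lindelof)
  have null: "T \<in> null_sets Q" if T: "T \<in> F'" for T
  proof -
    obtain f where "orthogonal_transformation f" "T = f -` S" using T F'(1) by (auto simp: F_def)
    then have "prob T = 0" using S0 S prob_vimage_orthogonal by simp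
    then show ?thesis using F_open T F'(1) by (auto simp: null_sets_def emeasure_eq_measure)
  qed
  have "\<Union>F' \<in> null_sets Q" using null_sets_UN'[OF F'(2), of "\<lambda>T. T"] null by simp
  moreover have "{y. axis undefined 1 \<bullet> y = 0} \<in> null_sets Q"
    using prob_hyperplane[of "axis undefined 1"]
    by (auto simp: null_sets_def emeasure_eq_measure axis_eq_0_iff closed_hyperplane)
  ultimately have "\<Union>F' \<union> {y. axis undefined 1 \<bullet> y = 0} \<in> null_sets Q" by (rule null_sets.Un)
  moreover have "\<Union>F' \<union> {y. axis undefined 1 \<bullet> y = 0} = UNIV"
  proof -
    have "y \<in> \<Union>F" if y: "y \<noteq> 0" for y
    proof -
      obtain z where z: "z \<in> S" "norm z = norm y" using meets[of "norm y"] y by auto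
      obtain f where "orthogonal_transformation f" "f y = z"
        using orthogonal_transformation_exists[of y z] z(2) by metis
      then show ?thesis using z(1) by (auto simp: F_def)
    qed
    then show ?thesis using F'(3) by (metis (mono_tags, lifting) UNIV_eq_I UnCI inner_zero_right mem_Collect_eq)
  qed
  ultimately show False using emeasure_space_1 by (auto simp: null_sets_def)
qed

lemma prob_uminus_halfspace:
  "prob {y. c \<le> - (a \<bullet> y)} = prob {y. c \<le> a \<bullet> y}"
proof -
  have "orthogonal_transformation (\<lambda>y :: real^'d. - y)"
    by (simp only: orthogonal_transformation_neg orthogonal_transformation_id)
  then have "prob ((\<lambda>y. - y) -` {y. c \<le> a \<bullet> y}) = prob {y. c \<le> a \<bullet> y}"
    by (rule prob_vimage_orthogonal) simp
  then show ?thesis by (simp add: vimage_def)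
qed

text \<open>
  The open strip between the half-space and its mirror image has positive mass: in dimension at
  least two it contains a line through the origin and so meets every sphere.
\<close>

lemma prob_halfspace_tail:
  assumes card: "CARD('d) \<ge> 2" and c: "0 < c"
  shows "prob {y. c \<le> a \<bullet> y} < 1/2"
proof -
  let ?strip = "{y. \<bar>a \<bullet> y\<bar> < c}"
  obtain z where z: "z \<noteq> 0" "orthogonal a z"
    using orthogonal_to_vector_exists[of a] card by auto
  have "0 < prob ?strip"
  proof (rule prob_open_meeting_spheres_pos)
    show "open ?strip" by (intro open_Collect_less continuous_intros)
    fix r :: real assume "0 < r"
    then show "\<exists>y\<in>?strip. norm y = r"
      using z c by (intro bexI[of _ "(r / norm z) *\<^sub>R z"]) (auto simp: orthogonal_def)
  qed
  moreover have "prob {y. c \<le> a \<bullet> y} + prob {y. c \<le> - (a \<bullet> y)} + prob ?strip = 1"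
  proof -
    have [measurable]: "{y. c \<le> a \<bullet> y} \<in> sets borel" "{y. c \<le> - (a \<bullet> y)} \<in> sets borel" "?strip \<in> sets borel"
      by measurable
    have "prob {y. c \<le> a \<bullet> y} + prob {y. c \<le> - (a \<bullet> y)} = prob ({y. c \<le> a \<bullet> y} \<union> {y. c \<le> - (a \<bullet> y)})"
      using c by (intro finite_measure_Union[symmetric]) auto
    also have "\<dots> + prob ?strip = prob (({y. c \<le> a \<bullet> y} \<union> {y. c \<le> - (a \<bullet> y)}) \<union> ?strip)"
      by (intro finite_measure_Union[symmetric]) auto
    also have "({y. c \<le> a \<bullet> y} \<union> {y. c \<le> - (a \<bullet> y)}) \<union> ?strip = space Q" by auto
    finally show ?thesis by (simp only: prob_space)
  qed
  ultimately show ?thesis using prob_uminus_halfspace[of c a] by linarith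
qed

lemma prob_Un_overlap_hyperplane:
  assumes "a \<noteq> 0" "A \<in> sets borel" "B \<in> sets borel" "A \<inter> B \<subseteq> {y. a \<bullet> y = 0}"
  shows "prob (A \<union> B) = prob A + prob B"
proof -
  have "prob (A \<inter> B) \<le> prob {y. a \<bullet> y = 0}"
    using assms by (intro finite_measure_mono) (auto simp: closed_hyperplane)
  then have "prob (A \<inter> B) = 0" using prob_hyperplane[OF assms(1)] measure_nonneg[of Q "A \<inter> B"] by linarith
  then show ?thesis using measure_Un3[of A Q B] assms by (simp add: fmeasurable_eq_sets)
qed

lemma prob_halfspace:
  assumes "a \<noteq> 0"
  shows "prob {y. 0 \<le> a \<bullet> y} = 1/2"
proof -
  have "prob ({y. 0 \<le> a \<bullet> y} \<union> {y. 0 \<le> - (a \<bullet> y)}) = prob {y. 0 \<le> a \<bullet> y} + prob {y. 0 \<le> - (a \<bullet> y)}"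
    by (rule prob_Un_overlap_hyperplane[OF assms]) auto
  moreover have "{y. 0 \<le> a \<bullet> y} \<union> {y. 0 \<le> - (a \<bullet> y)} = space Q" by auto
  ultimately show ?thesis using prob_uminus_halfspace[of 0 a] prob_space by simp
qed

text \<open>
  The reflection in the hyperplane orthogonal to \<open>b\<close> exchanges the two halves into which that
  hyperplane cuts the half-space of \<open>a\<close>.
\<close>

lemma prob_wedge_orthogonal:
  assumes "a \<noteq> 0" "b \<noteq> 0" and ab: "a \<bullet> b = 0"
  shows "prob (wedge a b) = 1/4"
proof -
  define f where "f y = y - (2 * (b \<bullet> y) / (b \<bullet> b)) *\<^sub>R b" for y
  have "a \<bullet> f y = a \<bullet> y" "b \<bullet> f y = - (b \<bullet> y)" for y
    using assms by (auto simp: f_def inner_simps field_simps)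
  then have "f -` wedge a b = wedge a (- b)" by (simp add: wedge_def vimage_def)
  moreover have "orthogonal_transformation f"
    unfolding f_def by (rule orthogonal_transformation_reflection)
  ultimately have eq: "prob (wedge a (- b)) = prob (wedge a b)"
    using prob_vimage_orthogonal[of f "wedge a b"] by (simp add: closed_wedge)
  have "prob (wedge a b \<union> wedge a (- b)) = prob (wedge a b) + prob (wedge a (- b))"
    by (rule prob_Un_overlap_hyperplane[OF assms(2)]) (auto simp: closed_wedge wedge_def)
  moreover have "wedge a b \<union> wedge a (- b) = {y. 0 \<le> a \<bullet> y}" by (auto simp: wedge_def)
  ultimately show ?thesis using eq prob_halfspace[OF assms(1)] by simp
qed

text \<open>
  The normals \<open>a\<close> and \<open>- b\<close> form an obtuse angle, so the wedge opens by less than a right angle. To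
  see that its mass drops strictly below one quarter, replace \<open>b\<close> by its component \<open>b'\<close> orthogonal
  to \<open>a\<close>: the wedge of \<open>a\<close> and \<open>- b'\<close> has mass one quarter and exceeds the given one by the open
  cone \<open>D\<close>, which has positive mass.
\<close>

lemma prob_narrow_wedge:
  assumes ab: "0 < a \<bullet> b" and indep: "\<And>k. b \<noteq> k *\<^sub>R a"
  shows "prob (wedge a (- b)) < 1/4"
proof -
  define k where "k = (a \<bullet> b) / (a \<bullet> a)"
  define b' where "b' = b - k *\<^sub>R a"
  have a: "a \<noteq> 0" using ab by auto
  have k: "0 < k" using ab a by (simp add: k_def)
  have b': "b' \<noteq> 0" using indep[of k] by (simp add: b'_def)
  have ab': "a \<bullet> b' = 0" using a by (simp add: b'_def k_def inner_simps)
  let ?D = "{y. 0 < a \<bullet> y \<and> 0 < b \<bullet> y \<and> b' \<bullet> y < 0}"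
  \<comment> \<open>A point of the cone: \<open>z\<close> is chosen with \<open>\<langle>a, z\<rangle> = 1\<close> and \<open>\<langle>b', z\<rangle> = - k / 2\<close>, whence \<open>\<langle>b, z\<rangle> = k / 2\<close>.\<close>
  define z where "z = a /\<^sub>R (a \<bullet> a) - ((k / 2) / (b' \<bullet> b')) *\<^sub>R b'"
  have az: "a \<bullet> z = 1" and b'z: "b' \<bullet> z = - (k / 2)"
    using a b' ab' by (simp_all add: z_def inner_simps inner_commute[of b' a])
  have "b = b' + k *\<^sub>R a" by (simp add: b'_def)
  then have bz: "b \<bullet> z = k / 2" using az b'z by (simp add: inner_simps)
  have D_open: "open ?D" by (intro open_Collect_conj open_Collect_less continuous_intros)
  have "0 < prob ?D"
  proof (rule prob_open_meeting_spheres_pos[OF D_open])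
    fix r :: real assume r: "0 < r"
    have "z \<noteq> 0" using az by auto
    then show "\<exists>y\<in>?D. norm y = r"
      using r k az bz b'z by (intro bexI[of _ "(r / norm z) *\<^sub>R z"]) (auto intro!: divide_pos_pos mult_pos_pos simp: mult_neg_pos)
  qed
  moreover have "prob ?D + prob (wedge a (- b)) = prob (?D \<union> wedge a (- b))"
    by (intro finite_measure_Union[symmetric]) (auto simp: closed_wedge D_open borel_open wedge_def)
  moreover have "prob (?D \<union> wedge a (- b)) \<le> prob (wedge a (- b'))"
  proof (rule finite_measure_mono)
    have "0 \<le> (- b') \<bullet> y" if "0 \<le> a \<bullet> y" "b \<bullet> y \<le> 0" for y
      using mult_nonneg_nonneg[OF less_imp_le[OF k] that(1)] that(2) by (simp add: b'_def inner_simps)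
    then show "?D \<union> wedge a (- b) \<subseteq> wedge a (- b')" by (auto simp: wedge_def)
  qed (simp add: closed_wedge)
  moreover have "prob (wedge a (- b')) = 1/4"
    using a b' ab' by (intro prob_wedge_orthogonal) auto
  ultimately show ?thesis by linarith
qed

end

lemma spherical_law_density:
  fixes g :: "real \<Rightarrow> real"
  assumes [measurable]: "g \<in> borel_measurable borel"
    and total: "(\<integral>\<^sup>+ y. ennreal (g ((norm (y :: real^'d))\<^sup>2)) \<partial>lborel) = 1"
  shows "spherical_law (density lborel (\<lambda>y :: real^'d. ennreal (g ((norm y)\<^sup>2))))"
    (is "spherical_law ?Q")
proof -
  interpret prob_space ?Q
    by (rule prob_spaceI) (simp add: emeasure_density total)
  show ?thesis
  proof
    show "sets ?Q = sets borel" by simp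
    fix f :: "real^'d \<Rightarrow> real^'d" assume f: "orthogonal_transformation f"
    then have [measurable]: "f \<in> borel_measurable borel"
      by (intro borel_measurable_continuous_onI continuous_on_orthogonal_transformation)
    have "distr ?Q borel f = distr (density lborel (\<lambda>y. ennreal (g ((norm (f y))\<^sup>2)))) borel f"
      using f by (simp add: orthogonal_transformation_norm)
    also have "\<dots> = density (distr lborel borel f) (\<lambda>y. ennreal (g ((norm y)\<^sup>2)))"
      by (rule density_distr[symmetric]) measurable
    finally show "distr ?Q borel f = ?Q"
      using f by (simp add: lborel_distr_orthogonal)
  next
    fix a :: "real^'d" assume "a \<noteq> 0"
    then have "{y. a \<bullet> y = 0} \<in> null_sets lborel"
      using negligible_hyperplane[of a 0]
      by (simp add: negligible_iff_null_sets null_sets_completion_iff closed_hyperplane borel_closed)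
    then have "{y. a \<bullet> y = 0} \<in> null_sets ?Q"
      using absolutely_continuousI_density[of "\<lambda>y :: real^'d. ennreal (g ((norm y)\<^sup>2))" lborel]
      by (auto simp: absolutely_continuous_def)
    then show "prob {y. a \<bullet> y = 0} = 0" by (simp add: measure_def null_setsD1)
  qed
qed

section \<open>Elliptical laws and the quarter median problem\<close>

text \<open>
  Substituting \<open>x = \<mu> + A y\<close> turns the quadratic form \<open>\<langle>x - \<mu>, (A A\<^sup>T)\<^sup>-\<^sup>1 (x - \<mu>)\<rangle>\<close> into \<open>\<parallel>y\<parallel>\<^sup>2\<close>, and the
  Jacobian cancels the factor \<open>sqrt (det (A A\<^sup>T))\<close> of the density.
\<close>

lemma elliptical_eq_distr_spherical:
  fixes \<mu> :: "real^'d" and U :: "real^'d^'d" and h :: "real \<Rightarrow> real"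
  assumes U: "orthogonal_matrix U" and s: "\<And>i. 0 < s i"
    and A: "A = transpose U ** diag_matrix s"
    and h: "h \<in> borel_measurable (restrict_space borel {0..})"
    and c: "0 < ell_const TYPE('d) h" "ell_const TYPE('d) h < \<infinity>"
  obtains Q where "spherical_law Q" "elliptical \<mu> (A ** transpose A) h = distr Q borel (\<lambda>y. \<mu> + A *v y)"
proof -
  define S where "S = A ** transpose A"
  define c where "c = enn2real (ell_const TYPE('d) h)"
  define p where "p = (\<Prod>i\<in>UNIV. s i)"
  \<comment> \<open>\<open>h\<close> is measurable on the nonnegative reals only; \<open>max 0\<close> extends it to a Borel function on the line.\<close>
  define g where "g t = h (max 0 t) / c" for t
  define B where "B = diag_matrix (\<lambda>i. 1 / s i) ** U"
  have c_pos: "0 < c" and c_eq: "ell_const TYPE('d) h = ennreal c"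
    using c by (simp_all add: c_def enn2real_positive_iff)
  have p_pos: "0 < p" using s by (auto simp: p_def intro: prod_pos)
  have UU: "U ** transpose U = mat 1" "transpose U ** U = mat 1"
    using U by (auto simp: orthogonal_matrix_def)
  have diag_inv: "diag_matrix (\<lambda>i. 1 / s i) ** diag_matrix s = mat 1" "diag_matrix s ** diag_matrix (\<lambda>i. 1 / s i) = mat 1"
    using s[THEN less_imp_neq, THEN not_sym] by (simp_all add: diag_matrix_mult diag_matrix_one)
  have BA: "B ** A = mat 1"
  proof -
    have "B ** A = diag_matrix (\<lambda>i. 1 / s i) ** (U ** transpose U) ** diag_matrix s"
      by (simp only: A B_def matrix_mul_assoc)
    then show ?thesis by (simp add: UU diag_inv)
  qed
  then have AB: "A ** B = mat 1" by (simp add: matrix_left_right_inverse)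
  have tBA: "transpose A ** transpose B = mat 1" "transpose B ** transpose A = mat 1"
    using AB BA by (metis matrix_transpose_mul transpose_mat)+
  have inv: "matrix_inv S = transpose B ** B"
  proof (rule matrix_inv_eqI)
    show "S ** (transpose B ** B) = mat 1"
      unfolding S_def by (metis AB tBA matrix_mul_assoc matrix_mul_rid)
    show "(transpose B ** B) ** S = mat 1"
      unfolding S_def by (metis BA tBA matrix_mul_assoc matrix_mul_rid)
  qed
  have quad: "x \<bullet> (matrix_inv S *v x) = (norm (B *v x))\<^sup>2" for x
    unfolding inv matrix_vector_mul_assoc[symmetric] power2_norm_eq_inner
    by (simp add: inner_matrix_vector_mult[of x] del: transpose_matrix_vector)
  have det: "sqrt (det S) = p"
  proof -
    have "det A = det U * p" by (simp add: A det_mul det_diag_matrix p_def)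
    moreover have "det U * det U = 1"
      by (metis UU(1) det_I det_mul det_transpose)
    ultimately have "det S = p\<^sup>2" by (simp add: S_def det_mul power2_eq_square algebra_simps)
    then show ?thesis using p_pos by simp
  qed
  have [measurable]: "g \<in> borel_measurable borel"
  proof -
    have "max 0 \<in> measurable borel (restrict_space borel {0::real..})"
      by (rule measurable_restrict_space2) auto
    then have "(\<lambda>t. h (max 0 t)) \<in> borel_measurable borel"
      using h by (rule measurable_compose)
    then show ?thesis by (simp add: g_def[abs_def])
  qed
  have [measurable]: "(\<lambda>y. M *v y) \<in> borel_measurable borel" for M :: "real^'d^'d"
    by (intro borel_measurable_continuous_onI continuous_intros)
  have g_sq: "g (r\<^sup>2) = h (r\<^sup>2) / c" for r by (simp add: g_def)
  define Q where "Q = density lborel (\<lambda>y :: real^'d. ennreal (g ((norm y)\<^sup>2)))"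
  have "spherical_law Q"
    unfolding Q_def
  proof (rule spherical_law_density)
    have "ennreal c * (\<integral>\<^sup>+ y. ennreal (g ((norm (y :: real^'d))\<^sup>2)) \<partial>lborel)
        = (\<integral>\<^sup>+ y. ennreal c * ennreal (g ((norm (y :: real^'d))\<^sup>2)) \<partial>lborel)"
      by (rule nn_integral_cmult[symmetric]) measurable
    also have "\<dots> = (\<integral>\<^sup>+ y. ennreal (h ((norm (y :: real^'d))\<^sup>2)) \<partial>lborel)"
      using c_pos by (simp add: g_sq ennreal_mult'[symmetric])
    also have "\<dots> = ennreal c" using c_eq by (simp add: ell_const_def)
    finally show "(\<integral>\<^sup>+ y. ennreal (g ((norm (y :: real^'d))\<^sup>2)) \<partial>lborel) = 1"
      using c_pos by (simp add: ennreal_mult_cancel_left[of "ennreal c" _ 1, simplified])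
  qed measurable
  moreover have "elliptical \<mu> S h = distr Q borel (\<lambda>y. \<mu> + A *v y)"
  proof -
    define f where "f x = ennreal (g ((norm (B *v (x - \<mu>)))\<^sup>2) / p)" for x
    have [measurable]: "f \<in> borel_measurable borel" unfolding f_def by measurable
    have "elliptical \<mu> S h = density lborel f"
      by (simp add: elliptical_def f_def[abs_def] quad det g_sq c_def mult.commute)
    also have "\<dots> = density (density (distr lborel borel (\<lambda>y. \<mu> + A *v y)) (\<lambda>_. ennreal p)) f"
      unfolding p_def A
      by (subst lborel_eq_density_distr_affine[of "transpose U" s \<mu>]) (use U s in auto)
    also have "\<dots> = density (distr lborel borel (\<lambda>y. \<mu> + A *v y)) (\<lambda>x. ennreal p * f x)"
      by (rule density_density_eq) measurable
    also have "\<dots> = distr (density lborel (\<lambda>y. ennreal p * f (\<mu> + A *v y))) borel (\<lambda>y. \<mu> + A *v y)"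
      by (rule density_distr) measurable
    also have "(\<lambda>y. ennreal p * f (\<mu> + A *v y)) = (\<lambda>y. ennreal (g ((norm y)\<^sup>2)))"
      using p_pos BA by (simp add: f_def matrix_vector_mul_assoc ennreal_mult'[symmetric])
    finally show ?thesis by (simp add: Q_def)
  qed
  ultimately show thesis using that by (simp add: S_def)
qed

definition sign_factor :: "sign \<Rightarrow> real" where
  "sign_factor s = (case s of Minus \<Rightarrow> - 1 | Plus \<Rightarrow> 1)"

lemma sign_factor_simps [simp]: "sign_factor Minus = - 1" "sign_factor Plus = 1"
  by (simp_all add: sign_factor_def)

lemma sign_factor_nonzero [simp]: "sign_factor s \<noteq> 0"
  by (cases s) auto

lemma closed_halfspace: "closed (halfspace s a b)"
  by (cases s) (auto intro!: closed_Collect_le continuous_intros)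

lemma affine_vimage_halfspace:
  fixes A :: "real^'d^'d"
  shows "(\<lambda>y. \<mu> + A *v y) -` halfspace s \<theta> v =
    {y. sign_factor s * (v \<bullet> (\<theta> - \<mu>)) \<le> (sign_factor s *\<^sub>R (v v* A)) \<bullet> y}"
  by (cases s) (auto simp: dot_lmul_matrix inner_simps)

text \<open>
  Pulled back to the spherical law, the half-spaces and quadrants at \<open>\<mu>\<close> become half-spaces and wedges
  through the origin with normals \<open>a i = A\<^sup>T v\<^sub>i\<close>, where \<open>v\<^sub>i\<close> is the \<open>i\<close>-th row of \<open>V\<close>, and
  \<open>\<langle>a i, a j\<rangle> = \<langle>v\<^sub>i, A A\<^sup>T v\<^sub>j\<rangle>\<close>. If \<open>\<theta>\<close> lies off the hyperplane of \<open>v\<^sub>i\<close> through \<open>\<mu>\<close>, one of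
  its two half-spaces is a tail of mass below one half. If \<open>\<langle>a i, a j\<rangle> \<noteq> 0\<close>, one of the four
  quadrants is a narrow wedge of mass below one quarter. If all these products vanish, every
  half-space has mass one half and every quadrant mass one quarter.
\<close>

theorem solves_qm_affine_spherical_iff:
  fixes \<mu> :: "real^'d::{finite,linorder}" and A :: "real^'d::{finite,linorder}^'d::{finite,linorder}"
  assumes Q: "spherical_law Q" and card: "CARD('d::{finite,linorder}) \<ge> 2" and A: "A ** B = mat 1"
  shows "solves_qm (distr Q borel (\<lambda>y. \<mu> + A *v y)) \<theta> V \<longleftrightarrow>
    \<theta> = \<mu> \<and> orthogonal_matrix V \<and> (\<forall>i j. i \<noteq> j \<longrightarrow> row i V \<bullet> ((A ** transpose A) *v row j V) = 0)"
    (is "solves_qm ?P \<theta> V \<longleftrightarrow> ?rhs")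
proof -
  interpret spherical_law Q by fact
  define a where "a i = row i V v* A" for i
  have [measurable]: "(\<lambda>y. \<mu> + A *v y) \<in> borel_measurable Q"
    unfolding measurable_cong_sets[OF sets_Q refl]
    by (intro borel_measurable_continuous_onI continuous_intros)
  have measure_P: "measure ?P T = prob ((\<lambda>y. \<mu> + A *v y) -` T)" if "closed T" for T
    using that by (simp add: measure_distr)
  have halfspace: "measure ?P (halfspace s \<theta> (row i V)) =
      prob {y. sign_factor s * (row i V \<bullet> (\<theta> - \<mu>)) \<le> (sign_factor s *\<^sub>R a i) \<bullet> y}" for s \<theta> i
    by (simp add: measure_P closed_halfspace affine_vimage_halfspace a_def)
  have quarter: "measure ?P (quarter_space s s' \<mu> (row i V) (row j V)) =
      prob (wedge (sign_factor s *\<^sub>R a i) (sign_factor s' *\<^sub>R a j))" for s s' i j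
    unfolding quarter_space_def
    by (simp add: measure_P closed_halfspace closed_Int affine_vimage_halfspace vimage_Int a_def wedge_def Collect_conj_eq)
  have a_inner: "a i \<bullet> a j = row i V \<bullet> ((A ** transpose A) *v row j V)" for i j
    by (simp add: a_def dot_lmul_matrix matrix_vector_mul_assoc[symmetric])
  have A_inj: "x = 0" if "x v* A = 0" for x
    using that A by (metis vector_matrix_mul_assoc vector_matrix_mul_rid vector_matrix_mult_0)
  show ?thesis
  proof
    assume sol: "solves_qm ?P \<theta> V"
    then have V: "orthogonal_matrix V" by (simp add: solves_qm_def)
    have center: "row i V \<bullet> (\<theta> - \<mu>) = 0" for i
    proof -
      have half: "1/2 \<le> prob {y. sign_factor s * (row i V \<bullet> (\<theta> - \<mu>)) \<le> (sign_factor s *\<^sub>R a i) \<bullet> y}" for s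
        using sol unfolding solves_qm_def halfspace by blast
      have "\<not> 0 < sign_factor s * (row i V \<bullet> (\<theta> - \<mu>))" for s
        using prob_halfspace_tail[OF card] half[of s] by (meson linorder_not_less)
      from this[of Minus] this[of Plus] show ?thesis by simp
    qed
    have "V *v (\<theta> - \<mu>) = 0"
      using center by (simp add: vec_eq_iff matrix_vector_mul_component row_def vec_lambda_eta)
    then have "transpose V *v (V *v (\<theta> - \<mu>)) = 0" by simp
    then have \<theta>: "\<theta> = \<mu>"
      using V by (simp add: matrix_vector_mul_assoc orthogonal_matrix_def del: transpose_matrix_vector)
    have le_ortho: "a i \<bullet> a j = 0" if ij: "i < j" for i j
    proof -
      have q: "1/4 \<le> prob (wedge (sign_factor s *\<^sub>R a i) (sign_factor s' *\<^sub>R a j))" for s s'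
        using sol ij unfolding solves_qm_def \<theta> quarter by blast
      have indep: "a j \<noteq> k *\<^sub>R a i" for k
      proof
        assume "a j = k *\<^sub>R a i"
        then have "(row j V - k *\<^sub>R row i V) v* A = 0"
          by (simp add: a_def vector_matrix_left_distrib vector_matrix_mult_diff_distrib scaleR_vector_matrix_assoc)
        then have "row j V = k *\<^sub>R row i V" using A_inj by fastforce
        moreover have "row j V \<bullet> row j V = 1" "row i V \<bullet> row j V = 0"
          using V ij by (auto simp: orthogonal_matrix_orthonormal_rows orthogonal_def norm_eq_1)
        ultimately show False by (metis inner_scaleR_left mult_zero_right zero_neq_one)
      qed
      then have indep': "- a j \<noteq> k *\<^sub>R a i" for k by (metis minus_minus scaleR_minus_left)
      have "\<not> 0 < a i \<bullet> a j"
        using prob_narrow_wedge[OF _ indep] q[of Plus Minus] by fastforce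
      moreover have "\<not> 0 < a i \<bullet> (- a j)"
        using prob_narrow_wedge[OF _ indep'] q[of Plus Plus] by fastforce
      ultimately show ?thesis by simp
    qed
    have "a i \<bullet> a j = 0" if "i \<noteq> j" for i j
      using that le_ortho[of i j] le_ortho[of j i] by (cases i j rule: linorder_cases) (auto simp: inner_commute)
    then show ?rhs using \<theta> V a_inner by simp
  next
    assume rhs: ?rhs
    then have \<theta>: "\<theta> = \<mu>" and V: "orthogonal_matrix V" and ortho: "\<And>i j. i \<noteq> j \<Longrightarrow> a i \<bullet> a j = 0"
      by (simp_all add: a_inner)
    have a_nz: "a i \<noteq> 0" for i
    proof
      assume "a i = 0"
      then have "row i V = 0" using A_inj by (simp add: a_def)
      moreover have "norm (row i V) = 1" using V by (simp add: orthogonal_matrix_orthonormal_rows)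
      ultimately show False by simp
    qed
    have "measure ?P (halfspace s \<theta> (row i V)) \<ge> 1/2" for i s
      using prob_halfspace[of "sign_factor s *\<^sub>R a i"] a_nz by (simp add: halfspace \<theta>)
    moreover have "measure ?P (quarter_space s s' \<theta> (row i V) (row j V)) \<ge> 1/4" if "i < j" for i j s s'
      using prob_wedge_orthogonal[of "sign_factor s *\<^sub>R a i" "sign_factor s' *\<^sub>R a j"] a_nz ortho that
      by (simp add: quarter \<theta>)
    ultimately show "solves_qm ?P \<theta> V" using V by (simp add: solves_qm_def)
  qed
qed

section \<open>Uniqueness of the quarter median\<close>

theorem theorem4:
  fixes \<mu> :: "real^'d::{finite,linorder}"
    and \<Sigma> :: "real^'d::{finite,linorder}^'d::{finite,linorder}"
    and h :: "real \<Rightarrow> real"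
  assumes "CARD('d::{finite,linorder}) \<ge> 2"
    and "sym_pos_def \<Sigma>"
    and "h \<in> borel_measurable (restrict_space borel {0..})"
    and "\<forall>t\<ge>0. h t \<ge> 0"
    and "0 < ell_const TYPE('d::{finite,linorder}) h" and "ell_const TYPE('d::{finite,linorder}) h < \<infinity>"
  shows "unique_quarter_median (elliptical \<mu> \<Sigma> h) \<mu> \<and>
    (strictly_elliptical \<Sigma> \<longrightarrow>
       (\<exists>U lam. ordered_diagonalization U lam \<Sigma>) \<and>
       (\<forall>U lam. ordered_diagonalization U lam \<Sigma> \<longrightarrow>
          unique_qm_solution (elliptical \<mu> \<Sigma> h) \<mu> U))"
proof -
  \<comment> \<open>This diagonalisation serves to build a factor \<open>A\<close>; the given \<open>U\<close> of the second claim may differ from \<open>U\<^sub>0\<close>.\<close>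
  obtain U\<^sub>0 lam\<^sub>0 where U0: "orthogonal_matrix U\<^sub>0" and lam0: "antimono lam\<^sub>0"
      and \<Sigma>0: "\<Sigma> = transpose U\<^sub>0 ** diag_matrix lam\<^sub>0 ** U\<^sub>0"
    using spectral_theorem_antimono[of \<Sigma>] assms(2) by (auto simp: sym_pos_def_def)
  have lam0_pos: "0 < lam\<^sub>0 i" for i
    by (rule diag_pos_if_sym_pos_def[OF assms(2) U0 \<Sigma>0])
  define A where "A = transpose U\<^sub>0 ** diag_matrix (\<lambda>i. sqrt (lam\<^sub>0 i))"
  have \<Sigma>A: "\<Sigma> = A ** transpose A"
  proof -
    have "A ** transpose A = transpose U\<^sub>0 ** (diag_matrix (\<lambda>i. sqrt (lam\<^sub>0 i)) ** diag_matrix (\<lambda>i. sqrt (lam\<^sub>0 i))) ** U\<^sub>0"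
      by (simp only: A_def matrix_transpose_mul transpose_transpose transpose_diag_matrix matrix_mul_assoc)
    then show ?thesis using lam0_pos by (simp add: diag_matrix_mult less_imp_le \<Sigma>0)
  qed
  obtain B where B: "A ** B = mat 1"
  proof -
    have "diag_matrix (\<lambda>i. sqrt (lam\<^sub>0 i)) ** diag_matrix (\<lambda>i. 1 / sqrt (lam\<^sub>0 i)) = mat 1"
      using lam0_pos[THEN less_imp_neq, THEN not_sym] by (simp add: diag_matrix_mult diag_matrix_one)
    then have "A ** (diag_matrix (\<lambda>i. 1 / sqrt (lam\<^sub>0 i)) ** U\<^sub>0) = mat 1"
      using U0 unfolding A_def orthogonal_matrix_def by (metis matrix_mul_assoc matrix_mul_rid)
    then show thesis by (rule that)
  qed
  obtain Q where Q: "spherical_law Q" and P: "elliptical \<mu> \<Sigma> h = distr Q borel (\<lambda>y. \<mu> + A *v y)"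
    using elliptical_eq_distr_spherical[OF U0 _ A_def assms(3,5,6)] lam0_pos \<Sigma>A by auto
  have solves_iff: "solves_qm (elliptical \<mu> \<Sigma> h) \<theta> V \<longleftrightarrow> \<theta> = \<mu> \<and> orthogonal_matrix V \<and>
      (\<forall>i j. i \<noteq> j \<longrightarrow> row i V \<bullet> (\<Sigma> *v row j V) = 0)" for \<theta> V
    unfolding P using solves_qm_affine_spherical_iff[OF Q assms(1) B] by (simp only: \<Sigma>A)
  have diagonalizer_solves: "solves_qm (elliptical \<mu> \<Sigma> h) \<mu> U"
    if U: "orthogonal_matrix U" and \<Sigma>U: "\<Sigma> = transpose U ** diag_matrix lam ** U" for U lam
  proof -
    have "U ** \<Sigma> ** transpose U = diag_matrix lam"
      using U \<Sigma>U by (rule orthogonal_conjugate_eq_diag)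
    then have "row i U \<bullet> (\<Sigma> *v row j U) = 0" if "i \<noteq> j" for i j
      using that by (simp add: diag_matrix_def flip: matrix_congruence_nth)
    then show ?thesis using U by (simp add: solves_iff)
  qed
  have "unique_quarter_median (elliptical \<mu> \<Sigma> h) \<mu>"
    using diagonalizer_solves[OF U0 \<Sigma>0] solves_iff
    by (auto simp: unique_quarter_median_def quarter_median_def)
  moreover have "ordered_diagonalization U\<^sub>0 lam\<^sub>0 \<Sigma>"
    using U0 lam0 \<Sigma>0 lam0_pos lists_eigenvalues_orthogonal_diagonalization[OF U0 \<Sigma>0]
    by (simp add: ordered_diagonalization_def)
  moreover have "unique_qm_solution (elliptical \<mu> \<Sigma> h) \<mu> U"
    if strict: "strictly_elliptical \<Sigma>" and diag: "ordered_diagonalization U lam \<Sigma>" for U lam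
  proof -
    have U: "orthogonal_matrix U" and \<Sigma>U: "\<Sigma> = transpose U ** diag_matrix lam ** U"
      using diag by (auto simp: ordered_diagonalization_def)
    have "inj lam"
      using strict diag inj_lists_eigenvalues
      by (auto simp: strictly_elliptical_def ordered_diagonalization_def)
    then have "hyperplane_equiv V U" if "solves_qm (elliptical \<mu> \<Sigma> h) \<theta> V" for \<theta> V
      unfolding hyperplane_equiv_def
      using that solves_iff by (intro row_hyperplanes_eq_if_diagonalizing[OF U \<Sigma>U]) auto
    then show ?thesis
      using diagonalizer_solves[OF U \<Sigma>U] solves_iff by (auto simp: unique_qm_solution_def)
  qed
  ultimately show ?thesis by blast
qed

end
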